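(* Let $\{\mathcal{L}_n\}$, $u_i^{\mathcal{R}}$, $u_i^{\mathcal{L}}$, $\mathcal{Y}_i^{\mathcal{R}}$, $\mathcal{Y}_i^{\mathcal{L}}$, $\mathcal{Z}_i^{\mathcal{R}}$, $\mathcal{Z}_i^{\mathcal{L}}$ be as defined in the context, let $n\ge1$, and let $x_j^{(n)}$, $j=1,2,\ldots,n$, be the zeros of $\mathcal{L}_n(x)$. Then the following biorthogonality relations hold: $$\sum_{i=0}^{n-1}\mathcal{Y}_i^{\mathcal{L}}(x_j^{(n)})\,\mathcal{Y}_i^{\mathcal{R}}(x_k^{(n)})\,\omega_{n,j,k}=\delta_{j,k},\quad j,k=1,2,\ldots,n,$$ $$\sum_{i=0}^{n-1}\mathcal{Z}_i^{\mathcal{L}}(x_j^{(n)})\,\mathcal{Z}_i^{\mathcal{R}}(x_k^{(n)})\,\omega_{n,j,k}=\delta_{j,k},\quad j,k=1,2,\ldots,n,$$ where the weight function $\omega_{n,j,k}$ is given by $$\omega_{n,j,k}^{-1}=-\sqrt{d_n}\,(x_k^{(n)}-i\omega)\,[u_n^{\mathcal{R}}]'(x_k^{(n)})\,u_{n-1}^{\mathcal{L}}(x_j^{(n)})\ne 0,\quad j,k=1,\ldots,n.$$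
   Context: Setting: $\omega\in\mathbb{R}\setminus\{0\}$; $\{\rho_n\}_{n\ge0}$, $\{c_n\}_{n\ge0}$ are real sequences with $\rho_n\ge1$; $\{d_n\}_{n\ge1}$ is a positive chain sequence, i.e. there is $\{\xi_n\}_{n\ge0}$ with $0\le\xi_0<1$, $0<\xi_n<1$ $(n\ge1)$ and $d_n=(1-\xi_{n-1})\xi_n$. The polynomials $\mathcal{P}_n$ are generated by $\mathcal{P}_{-1}=0$, $\mathcal{P}_0=1$, $\mathcal{P}_1=\rho_0(x-c_0)$, $\mathcal{P}_{n+1}=\rho_n(x-c_n)\mathcal{P}_n-d_n(x^2+\omega^2)\mathcal{P}_{n-1}$ $(n\ge1)$, and $\mathcal{L}_n=\mathcal{P}_n-\alpha_n\mathcal{P}_{n-1}$ with nonzero real $\alpha_n$ satisfying, for all $n\ge1$, $$\alpha_n=\rho_{n-1}(1-c_{n-1})-\omega^2\alpha_{n-1}^{-1}d_{n-1},\qquad d_n\alpha_{n-1}\rho_{n-1}=d_{n-1}\alpha_n\rho_n$$ ($d_0$ and $\alpha_0\ne0$ are auxiliary real constants not influencing the polynomials). Under these conditions $\mathcal{L}_0=1$, $\mathcal{L}_1=\rho_0(x-\alpha_1\rho_0^{-1}-c_0)$ and $\mathcal{L}_{n+1}=\rho_n\bigl(x-f_n^{-1}s_n/\rho_n\bigr)\mathcal{L}_n-d_n(x^2+\omega^2)\mathcal{L}_{n-1}$ for $n\ge1$, where $f_n=-\alpha_{n-1}\rho_{n-1}$ and $s_n=-(\alpha_{n-1}\rho_{n-1}c_{n-1}+d_{n-1}\omega^2)(\rho_nc_n+\alpha_{n+1})+\alpha_{n-1}d_n\omega^2$.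 Rational functions: $u_0^{\mathcal{R}}=u_0^{\mathcal{L}}=\mathcal{L}_0$ and for $k\ge1$ $$u_k^{\mathcal{R}}(x)=\frac{(-1)^k\mathcal{L}_k(x)}{(x-i\omega)^k\prod_{j=1}^k\sqrt{d_j}},\qquad u_k^{\mathcal{L}}(x)=\frac{(-1)^k\mathcal{L}_k(x)}{(x+i\omega)^k\prod_{j=1}^k\sqrt{d_j}}.$$ Let $\mathcal{J}_n$ be the (positive definite) symmetric tridiagonal $n\times n$ matrix with diagonal $\rho_0,\ldots,\rho_{n-1}$ and off-diagonal entries $\sqrt{d_1},\ldots,\sqrt{d_{n-1}}$. (UL factorization, Darboux transformation.) $\mathcal{J}_n=\mathcal{C}_n^T\mathcal{C}_n$, where $\mathcal{C}_n$ is lower bidiagonal with diagonal entries $m_0,\ldots,m_{n-1}$ and subdiagonal entries $\ell_1,\ldots,\ell_{n-1}$; here $m_0>0$ is the free parameter, $\ell_{i+1}=\sqrt{\rho_i-m_i^2}$ for $0\le i\le n-1$, $m_{i+1}=\sqrt{d_{i+1}}/\sqrt{\rho_i-m_i^2}$ for $0\le i\le n-2$ (with $\rho_i>m_i^2$ for $0\le i\le n-2$), and $m_0$ is such that the additional assumption $\ell_n=0$ holds. For $\bullet\in\{\mathcal{L},\mathcal{R}\}$ define $$\mathcal{Y}_0^{\bullet}(x)=m_0u_0^{\bullet}(x),\qquad \mathcal{Y}_{i+1}^{\bullet}(x)=\ell_{i+1}u_i^{\bullet}(x)+m_{i+1}u_{i+1}^{\bullet}(x)\ (0\le i\le n-2).$$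 (LDU factorization.) Let $e_0=\rho_0$, $e_i=\rho_i-d_i/e_{i-1}$ $(1\le i\le n-1)$, the diagonal entries of $\mathcal{D}_n$ in the square-root free Cholesky decomposition $\mathcal{J}_n=\mathcal{S}_n\mathcal{D}_n\mathcal{S}_n^T$ with $\mathcal{S}_n$ unit lower bidiagonal. For $\bullet\in\{\mathcal{L},\mathcal{R}\}$ define $$\mathcal{Z}_i^{\bullet}(x)=\sqrt{e_i}\,u_i^{\bullet}(x)+\sqrt{d_{i+1}/e_i}\,u_{i+1}^{\bullet}(x)\ (0\le i\le n-2),\qquad \mathcal{Z}_{n-1}^{\bullet}(x)=\sqrt{e_{n-1}}\,u_{n-1}^{\bullet}(x).$$ *)

theory Defs
  imports "HOL-Analysis.Analysis" "HOL-Computational_Algebra.Computational_Algebra"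
begin

text \<open>
  Sequences are functions on \<^typ>\<open>nat\<close>. For \<open>d\<close> only the indices \<open>n \<ge> 1\<close> matter to the chain
  sequence condition and to the polynomials; \<open>d 0\<close> and \<open>\<alpha> 0\<close> are the auxiliary constants of the
  relations defining \<open>\<alpha>\<close>.
\<close>

definition positive_chain_sequence :: "(nat \<Rightarrow> real) \<Rightarrow> bool" where
  "positive_chain_sequence d \<longleftrightarrow>
     (\<exists>\<xi> :: nat \<Rightarrow> real. 0 \<le> \<xi> 0 \<and> \<xi> 0 < 1 \<and>
        (\<forall>n\<ge>1. 0 < \<xi> n \<and> \<xi> n < 1 \<and> d n = (1 - \<xi> (n - 1)) * \<xi> n))"

fun P_poly :: "real \<Rightarrow> (nat \<Rightarrow> real) \<Rightarrow> (nat \<Rightarrow> real) \<Rightarrow> (nat \<Rightarrow> real) \<Rightarrow> nat \<Rightarrow> real poly" where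
  "P_poly \<omega> \<rho> c d 0 = 1"
| "P_poly \<omega> \<rho> c d (Suc 0) = smult (\<rho> 0) [:- c 0, 1:]"
| "P_poly \<omega> \<rho> c d (Suc (Suc n)) =
     smult (\<rho> (Suc n)) [:- c (Suc n), 1:] * P_poly \<omega> \<rho> c d (Suc n)
     - smult (d (Suc n)) [:\<omega>\<^sup>2, 0, 1:] * P_poly \<omega> \<rho> c d n"

text \<open>The case \<open>n = 0\<close> encodes the convention that the polynomial of index \<open>-1\<close> is zero.\<close>

definition L_poly :: "real \<Rightarrow> (nat \<Rightarrow> real) \<Rightarrow> (nat \<Rightarrow> real) \<Rightarrow> (nat \<Rightarrow> real) \<Rightarrow> (nat \<Rightarrow> real) \<Rightarrow>
    nat \<Rightarrow> real poly" where
  "L_poly \<omega> \<rho> c d \<alpha> n =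
     P_poly \<omega> \<rho> c d n - smult (\<alpha> n) (if n = 0 then 0 else P_poly \<omega> \<rho> c d (n - 1))"

abbreviation L_cpoly :: "real \<Rightarrow> (nat \<Rightarrow> real) \<Rightarrow> (nat \<Rightarrow> real) \<Rightarrow> (nat \<Rightarrow> real) \<Rightarrow> (nat \<Rightarrow> real) \<Rightarrow>
    nat \<Rightarrow> complex poly" where
  "L_cpoly \<omega> \<rho> c d \<alpha> n \<equiv> map_poly complex_of_real (L_poly \<omega> \<rho> c d \<alpha> n)"

definition uR :: "real \<Rightarrow> (nat \<Rightarrow> real) \<Rightarrow> (nat \<Rightarrow> real) \<Rightarrow> (nat \<Rightarrow> real) \<Rightarrow> (nat \<Rightarrow> real) \<Rightarrow>
    nat \<Rightarrow> complex \<Rightarrow> complex" where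
  "uR \<omega> \<rho> c d \<alpha> k z =
     (-1) ^ k * poly (L_cpoly \<omega> \<rho> c d \<alpha> k) z /
       ((z - \<i> * of_real \<omega>) ^ k * of_real (\<Prod>j=1..k. sqrt (d j)))"

definition uL :: "real \<Rightarrow> (nat \<Rightarrow> real) \<Rightarrow> (nat \<Rightarrow> real) \<Rightarrow> (nat \<Rightarrow> real) \<Rightarrow> (nat \<Rightarrow> real) \<Rightarrow>
    nat \<Rightarrow> complex \<Rightarrow> complex" where
  "uL \<omega> \<rho> c d \<alpha> k z =
     (-1) ^ k * poly (L_cpoly \<omega> \<rho> c d \<alpha> k) z /
       ((z + \<i> * of_real \<omega>) ^ k * of_real (\<Prod>j=1..k. sqrt (d j)))"

text \<open>
  Diagonal entries \<open>m\<close> and subdiagonal entries \<open>\<ell>\<close> (from index 1 on) of the lower bidiagonal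
  factor \<open>C\<close> in the UL factorization \<open>J = C\<^sup>T C\<close>, started from the free parameter \<open>m\<^sub>0\<close>.
\<close>

primrec UL_m :: "(nat \<Rightarrow> real) \<Rightarrow> (nat \<Rightarrow> real) \<Rightarrow> real \<Rightarrow> nat \<Rightarrow> real" where
  "UL_m \<rho> d m0 0 = m0"
| "UL_m \<rho> d m0 (Suc i) = sqrt (d (Suc i)) / sqrt (\<rho> i - (UL_m \<rho> d m0 i)\<^sup>2)"

definition UL_l :: "(nat \<Rightarrow> real) \<Rightarrow> (nat \<Rightarrow> real) \<Rightarrow> real \<Rightarrow> nat \<Rightarrow> real" where
  "UL_l \<rho> d m0 i = sqrt (\<rho> (i - 1) - (UL_m \<rho> d m0 (i - 1))\<^sup>2)"

text \<open>
  Diagonal entries of the diagonal factor in the square-root free Cholesky decomposition of \<open>J\<close>.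
\<close>

primrec LDU_e :: "(nat \<Rightarrow> real) \<Rightarrow> (nat \<Rightarrow> real) \<Rightarrow> nat \<Rightarrow> real" where
  "LDU_e \<rho> d 0 = \<rho> 0"
| "LDU_e \<rho> d (Suc i) = \<rho> (Suc i) - d (Suc i) / LDU_e \<rho> d i"

text \<open>The transforms below are applied to \<open>u = uL \<dots>\<close> and to \<open>u = uR \<dots>\<close>.\<close>

primrec Y_fun :: "(nat \<Rightarrow> real) \<Rightarrow> (nat \<Rightarrow> real) \<Rightarrow> real \<Rightarrow> (nat \<Rightarrow> complex \<Rightarrow> complex) \<Rightarrow>
    nat \<Rightarrow> complex \<Rightarrow> complex" where
  "Y_fun \<rho> d m0 u 0 = (\<lambda>z. of_real m0 * u 0 z)"
| "Y_fun \<rho> d m0 u (Suc i) =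
     (\<lambda>z. of_real (UL_l \<rho> d m0 (Suc i)) * u i z + of_real (UL_m \<rho> d m0 (Suc i)) * u (Suc i) z)"

definition Z_fun :: "(nat \<Rightarrow> real) \<Rightarrow> (nat \<Rightarrow> real) \<Rightarrow> nat \<Rightarrow> (nat \<Rightarrow> complex \<Rightarrow> complex) \<Rightarrow>
    nat \<Rightarrow> complex \<Rightarrow> complex" where
  "Z_fun \<rho> d n u i z =
     (if i = n - 1 then of_real (sqrt (LDU_e \<rho> d i)) * u i z
      else of_real (sqrt (LDU_e \<rho> d i)) * u i z
           + of_real (sqrt (d (Suc i) / LDU_e \<rho> d i)) * u (Suc i) z)"

text \<open>
  The reciprocal of the weight \<open>\<omega>\<^sub>n\<^sub>,\<^sub>j\<^sub>,\<^sub>k\<close>, as a function of the two zeros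
  \<open>xj = x\<^sub>j\<close> and \<open>xk = x\<^sub>k\<close>.
\<close>

definition weight_recip :: "real \<Rightarrow> (nat \<Rightarrow> real) \<Rightarrow> (nat \<Rightarrow> real) \<Rightarrow> (nat \<Rightarrow> real) \<Rightarrow> (nat \<Rightarrow> real) \<Rightarrow>
    nat \<Rightarrow> complex \<Rightarrow> complex \<Rightarrow> complex" where
  "weight_recip \<omega> \<rho> c d \<alpha> n xj xk =
     - of_real (sqrt (d n)) * (xk - \<i> * of_real \<omega>) *
       deriv (uR \<omega> \<rho> c d \<alpha> n) xk * uL \<omega> \<rho> c d \<alpha> (n - 1) xj"

end

theory Submission
  imports Defs
begin

text \<open>
  For zeros \<open>y\<close>, \<open>x\<close> of \<open>L\<^sub>n\<close> put \<open>S(y, x) = u\<^sup>L(y)\<^sup>T J u\<^sup>R(x)\<close>, where \<open>u\<^sup>L(y)\<close> and \<open>u\<^sup>R(x)\<close> are the vectors of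
  the first \<open>n\<close> rational functions. Since \<open>J = C\<^sup>T C\<close> and \<open>J = U D U\<^sup>T\<close> with \<open>U\<close> unit lower
  bidiagonal, and the transformed functions are the entries of \<open>C u\<close> and of \<open>D\<^sup>1\<^sup>/\<^sup>2 U\<^sup>T u\<close>, both sums
  of the theorem, taken without the weight, equal \<open>S(y, x)\<close> (lemmas \<open>sum_Y_eq_tridiag_form\<close> and \<open>sum_Z_eq_tridiag_form\<close>).

  The conditions on \<open>\<alpha>\<close> give the \<open>L\<^sub>n\<close> a three-term recurrence with real coefficients
  (lemma \<open>Lc_rec\<close>). It turns into recurrences for \<open>u\<^sup>R\<close> and \<open>u\<^sup>L\<close>, that is, into a generalized
  eigenvalue problem for the pencil \<open>x J - K\<close>, where \<open>K\<close> is Hermitian and tridiagonal, and these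
  yield the Christoffel--Darboux identity (lemma \<open>christoffel_darboux\<close>)

  \<open>(x - y) S(y, x) = - sqrt d\<^sub>n ((x - \<i>\<omega>) u\<^sup>L\<^sub>n\<^sub>-\<^sub>1(y) u\<^sup>R\<^sub>n(x) - (y + \<i>\<omega>) u\<^sup>L\<^sub>n(y) u\<^sup>R\<^sub>n\<^sub>-\<^sub>1(x))\<close>.

  At two distinct zeros of \<open>L\<^sub>n\<close> it gives \<open>S(y, x) = 0\<close>, and letting \<open>x\<close> tend to a zero \<open>y\<close> it gives
  that \<open>S(y, y)\<close> is the reciprocal of the weight at \<open>j = k\<close> (lemma \<open>tridiag_form_at_zero\<close>).

  It remains to see that the weights exist. For a zero \<open>x\<close>, \<open>S(cnj x, x)\<close> is the sum of the squared
  moduli of the entries of \<open>C u\<^sup>R(x)\<close>, so it is at least \<open>m\<^sub>0\<^sup>2 > 0\<close>. As \<open>cnj x\<close> is a zero as well, the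
  identity forces \<open>x\<close> to be real. Therefore \<open>S(x, x) \<noteq> 0\<close>, all factors of the weight are nonzero at the
  zeros, and the zeros are simple, so that \<open>x\<^sub>j \<noteq> x\<^sub>k\<close> for \<open>j \<noteq> k\<close>.
\<close>

section \<open>The tridiagonal form and its two factorizations\<close>

text \<open>
  The bilinear form \<open>v\<^sup>T J w\<close> of the \<open>n \<times> n\<close> tridiagonal matrix \<open>J\<close> with diagonal entries \<open>\<rho> 0\<close>, \<open>\<dots>\<close>
  and off-diagonal entries \<open>sqrt (d 1)\<close>, \<open>\<dots>\<close>. Only the first \<open>n\<close> entries of \<open>v\<close> and \<open>w\<close> are used.
\<close>

definition tridiag_form :: "(nat \<Rightarrow> real) \<Rightarrow> (nat \<Rightarrow> real) \<Rightarrow> nat \<Rightarrow> (nat \<Rightarrow> complex) \<Rightarrow>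
    (nat \<Rightarrow> complex) \<Rightarrow> complex" where
  "tridiag_form \<rho> d n v w =
     (\<Sum>i<n. of_real (\<rho> i) * v i * w i)
     + (\<Sum>i<n - 1. of_real (sqrt (d (Suc i))) * (v i * w (Suc i) + v (Suc i) * w i))"

lemma tridiag_form_1: "tridiag_form \<rho> d (Suc 0) v w = of_real (\<rho> 0) * v 0 * w 0"
  by (simp add: tridiag_form_def)

lemma tridiag_form_Suc_Suc:
  "tridiag_form \<rho> d (Suc (Suc n)) v w =
     tridiag_form \<rho> d (Suc n) v w + of_real (\<rho> (Suc n)) * v (Suc n) * w (Suc n)
     + of_real (sqrt (d (Suc n))) * (v n * w (Suc n) + v (Suc n) * w n)"
  by (simp add: tridiag_form_def)

text \<open>
  The leading \<open>Suc N\<close> rows of \<open>C\<close> give \<open>J\<close> except in its last diagonal entry: there they yield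
  \<open>m\<^sub>N\<^sup>2\<close> instead of \<open>\<rho> N\<close>, and the difference is what the vanishing of the last \<open>\<ell>\<close> removes.
\<close>

lemma sum_Y_partial:
  assumes "\<And>i. i < N \<Longrightarrow> (UL_m \<rho> d m0 i)\<^sup>2 < \<rho> i"
  shows "(\<Sum>i<Suc N. Y_fun \<rho> d m0 u i y * Y_fun \<rho> d m0 v i x) =
    tridiag_form \<rho> d (Suc N) (\<lambda>i. u i y) (\<lambda>i. v i x)
    - of_real (\<rho> N - (UL_m \<rho> d m0 N)\<^sup>2) * u N y * v N x"
  using assms
proof (induction N)
  case 0
  then show ?case by (simp add: tridiag_form_1 power2_eq_square algebra_simps)
next
  case (Suc N)
  define l m s where "l = UL_l \<rho> d m0 (Suc N)" and "m = UL_m \<rho> d m0 (Suc N)"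
    and "s = sqrt (d (Suc N))"
  have pos: "(UL_m \<rho> d m0 N)\<^sup>2 < \<rho> N" using Suc.prems by blast
  have ll: "\<rho> N - (UL_m \<rho> d m0 N)\<^sup>2 = l * l" and lm: "s = l * m"
    using pos by (simp_all add: l_def m_def s_def UL_l_def)
  have IH: "(\<Sum>i<Suc N. Y_fun \<rho> d m0 u i y * Y_fun \<rho> d m0 v i x) =
    tridiag_form \<rho> d (Suc N) (\<lambda>i. u i y) (\<lambda>i. v i x)
    - of_real (\<rho> N - (UL_m \<rho> d m0 N)\<^sup>2) * u N y * v N x"
    using Suc by simp
  show ?case
    unfolding sum.lessThan_Suc[of _ "Suc N"] IH ll tridiag_form_Suc_Suc Y_fun.simps
      l_def[symmetric] m_def[symmetric] s_def[symmetric] lm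
    by (simp add: algebra_simps power2_eq_square)
qed

lemma sum_Y_eq_tridiag_form:
  assumes "n \<ge> 1" "\<And>i. i + 1 < n \<Longrightarrow> (UL_m \<rho> d m0 i)\<^sup>2 < \<rho> i" "UL_l \<rho> d m0 n = 0"
  shows "(\<Sum>i<n. Y_fun \<rho> d m0 u i y * Y_fun \<rho> d m0 v i x) =
    tridiag_form \<rho> d n (\<lambda>i. u i y) (\<lambda>i. v i x)"
proof -
  obtain N where n: "n = Suc N" using assms(1) by (cases n) auto
  have "\<rho> N - (UL_m \<rho> d m0 N)\<^sup>2 = 0" using assms(3) by (simp add: n UL_l_def)
  then show ?thesis using sum_Y_partial[of N \<rho> d m0 u y v x] assms(2) by (simp add: n)
qed

lemma LDU_e_pos:
  assumes "\<And>k. \<rho> k \<ge> 1" and "positive_chain_sequence d"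
  shows "LDU_e \<rho> d i > 0"
proof -
  obtain \<xi> where \<xi>0: "0 \<le> \<xi> 0" "\<xi> 0 < 1"
    and \<xi>: "\<And>n. n \<ge> 1 \<Longrightarrow> 0 < \<xi> n \<and> \<xi> n < 1 \<and> d n = (1 - \<xi> (n - 1)) * \<xi> n"
    using assms(2) unfolding positive_chain_sequence_def by blast
  have \<xi>_less: "\<xi> k < 1" for k using \<xi>0 \<xi>[of k] by (cases k) auto
  \<comment> \<open>The parameters of the chain sequence bound the pivots from below.\<close>
  have "LDU_e \<rho> d i \<ge> 1 - \<xi> i"
  proof (induction i)
    case 0
    then show ?case using assms(1)[of 0] \<xi>0 by simp
  next
    case (Suc i)
    have "d (Suc i) / LDU_e \<rho> d i \<le> d (Suc i) / (1 - \<xi> i)"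
      using Suc \<xi>_less[of i] \<xi>[of "Suc i"] by (intro divide_left_mono) auto
    also have "\<dots> = \<xi> (Suc i)" using \<xi>[of "Suc i"] \<xi>_less[of i] by simp
    finally show ?case using assms(1)[of "Suc i"] by simp
  qed
  then show ?thesis using \<xi>_less[of i] by linarith
qed

lemma sum_Z_eq_tridiag_form:
  assumes "n \<ge> 1" "\<And>i. LDU_e \<rho> d i > 0" "\<And>i. i \<ge> 1 \<Longrightarrow> d i > 0"
  shows "(\<Sum>i<n. Z_fun \<rho> d n u i y * Z_fun \<rho> d n v i x) =
    tridiag_form \<rho> d n (\<lambda>i. u i y) (\<lambda>i. v i x)"
proof -
  define a b where "a i = sqrt (LDU_e \<rho> d i)" and "b i = sqrt (d (Suc i) / LDU_e \<rho> d i)" for i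
  have aa: "LDU_e \<rho> d i = a i * a i" and ab: "sqrt (d (Suc i)) = a i * b i"
    and bb: "d (Suc i) / LDU_e \<rho> d i = b i * b i" for i
    using assms(2)[of i] assms(3)[of "Suc i"] by (simp_all add: a_def b_def real_sqrt_divide)
  have partial: "(\<Sum>i<N. (of_real (a i) * u i y + of_real (b i) * u (Suc i) y)
          * (of_real (a i) * v i x + of_real (b i) * v (Suc i) x))
        + of_real (LDU_e \<rho> d N) * u N y * v N x
      = tridiag_form \<rho> d (Suc N) (\<lambda>i. u i y) (\<lambda>i. v i x)" for N
  proof (induction N)
    case 0
    then show ?case by (simp add: tridiag_form_1)
  next
    case (Suc N)
    have "LDU_e \<rho> d (Suc N) = \<rho> (Suc N) - b N * b N"
      unfolding bb[symmetric] by simp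
    then have e: "complex_of_real (LDU_e \<rho> d (Suc N)) = of_real (\<rho> (Suc N)) - of_real (b N * b N)"
      by (simp only: of_real_diff)
    show ?case
      unfolding tridiag_form_Suc_Suc Suc[symmetric] ab e aa[of N] sum.lessThan_Suc
      by (simp add: algebra_simps)
  qed
  obtain N where n: "n = Suc N" using assms(1) by (cases n) auto
  have "(\<Sum>i<N. Z_fun \<rho> d n u i y * Z_fun \<rho> d n v i x) =
      (\<Sum>i<N. (of_real (a i) * u i y + of_real (b i) * u (Suc i) y)
          * (of_real (a i) * v i x + of_real (b i) * v (Suc i) x))"
    by (intro sum.cong) (auto simp: Z_fun_def n a_def b_def)
  moreover have "Z_fun \<rho> d n u N y * Z_fun \<rho> d n v N x = of_real (LDU_e \<rho> d N) * u N y * v N x"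
    unfolding aa of_real_mult by (simp add: Z_fun_def n a_def[symmetric] algebra_simps)
  ultimately show ?thesis using partial[of N] by (simp add: n)
qed

section \<open>Recurrence relations\<close>

lemma map_poly_of_real_diff:
  "map_poly of_real (p - q) = (map_poly of_real p - map_poly of_real q :: complex poly)"
  by (intro poly_eqI) (simp add: coeff_map_poly)

lemma map_poly_of_real_mult:
  "map_poly of_real (p * q) = (map_poly of_real p * map_poly of_real q :: complex poly)"
  by (intro poly_eqI) (simp add: coeff_map_poly coeff_mult)

lemma map_poly_of_real_smult:
  "map_poly of_real (smult a p) = (smult (of_real a) (map_poly of_real p) :: complex poly)"
  by (intro poly_eqI) (simp add: coeff_map_poly)

text \<open>
  The data defining the \<open>L\<^sub>n\<close>. The recurrences and the location of the zeros need the chain sequence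
  \<open>d\<close> only through its positivity.
\<close>

locale kernel_recurrence =
  fixes \<omega> :: real and \<rho> c d \<alpha> :: "nat \<Rightarrow> real"
  assumes \<omega>_nz: "\<omega> \<noteq> 0"
    and \<rho>_ge_1: "\<And>k. \<rho> k \<ge> 1"
    and d_pos: "\<And>k. k \<ge> 1 \<Longrightarrow> d k > 0"
    and \<alpha>_nz: "\<And>k. \<alpha> k \<noteq> 0"
    and \<alpha>_rec: "\<And>k. k \<ge> 1 \<Longrightarrow>
           \<alpha> k = \<rho> (k - 1) * (1 - c (k - 1)) - \<omega>\<^sup>2 * inverse (\<alpha> (k - 1)) * d (k - 1)"
    and d_\<alpha>_rec: "\<And>k. k \<ge> 1 \<Longrightarrow> d k * \<alpha> (k - 1) * \<rho> (k - 1) = d (k - 1) * \<alpha> k * \<rho> k"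
begin

lemma \<rho>_nz: "\<rho> k \<noteq> 0"
  using \<rho>_ge_1[of k] by linarith

lemma d_nz: "d k \<noteq> 0"
proof (cases k)
  case 0
  \<comment> \<open>\<open>d 0\<close> is not part of the chain sequence; it is nonzero since \<open>d 1\<close> is a multiple of it.\<close>
  have "d 1 * \<alpha> 0 * \<rho> 0 \<noteq> 0" using d_pos[of 1] \<alpha>_nz \<rho>_nz by simp
  then show ?thesis using d_\<alpha>_rec[of 1] 0 by auto
next
  case (Suc m)
  then show ?thesis using d_pos[of k] by simp
qed

text \<open>
  By the second relation \<open>d\<^sub>k / (\<alpha>\<^sub>k \<rho>\<^sub>k)\<close> does not depend on \<open>k\<close>, so that the first relation expresses
  \<open>\<alpha>\<^sub>k\<^sub>+\<^sub>1 / \<rho>\<^sub>k + c\<^sub>k\<close> as a constant.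
\<close>

lemma \<alpha>_shift:
  "\<rho> (Suc n) * c (Suc n) + \<alpha> (Suc (Suc n)) = \<rho> (Suc n) * (c n + \<alpha> (Suc n) / \<rho> n)"
proof -
  have 1: "\<alpha> (Suc n) / \<rho> n = 1 - c n - \<omega>\<^sup>2 * (d n / (\<alpha> n * \<rho> n))"
    using \<alpha>_rec[of "Suc n"] \<rho>_nz[of n] \<alpha>_nz[of n] by (simp add: field_simps)
  have 2: "\<alpha> (Suc (Suc n)) / \<rho> (Suc n) =
      1 - c (Suc n) - \<omega>\<^sup>2 * (d (Suc n) / (\<alpha> (Suc n) * \<rho> (Suc n)))"
    using \<alpha>_rec[of "Suc (Suc n)"] \<rho>_nz[of "Suc n"] \<alpha>_nz[of "Suc n"] by (simp add: field_simps)
  have "d (Suc n) / (\<alpha> (Suc n) * \<rho> (Suc n)) = d n / (\<alpha> n * \<rho> n)"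
    using d_\<alpha>_rec[of "Suc n"] \<rho>_nz \<alpha>_nz by (simp add: field_simps)
  with 1 2 have "c (Suc n) + \<alpha> (Suc (Suc n)) / \<rho> (Suc n) = c n + \<alpha> (Suc n) / \<rho> n" by simp
  then show ?thesis using \<rho>_nz[of "Suc n"] by (simp add: field_simps)
qed

abbreviation Lc :: "nat \<Rightarrow> complex \<Rightarrow> complex" where
  "Lc n \<equiv> poly (L_cpoly \<omega> \<rho> c d \<alpha> n)"

text \<open>
  The zero of the linear factor in the recurrence of the \<open>L\<^sub>n\<close>. For \<open>k \<ge> 1\<close> the relations for \<open>\<alpha>\<close>
  make the quotient \<open>s\<^sub>k / (f\<^sub>k \<rho>\<^sub>k)\<close> equal to \<open>c\<^sub>k\<^sub>-\<^sub>1\<close>.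
\<close>

definition \<gamma> :: "nat \<Rightarrow> real" where
  "\<gamma> k = (if k = 0 then c 0 + \<alpha> 1 / \<rho> 0 else c (k - 1))"

lemma Lc_0: "Lc 0 z = 1"
  by (simp add: L_poly_def)

lemma Lc_1:
  fixes z :: complex
  shows "Lc (Suc 0) z = \<rho> 0 * (z - \<gamma> 0)"
  using \<rho>_nz[of 0] by (simp add: L_poly_def \<gamma>_def map_poly_of_real_diff
      map_poly_of_real_smult map_poly_pCons field_simps)

lemma L_poly_rec:
  "L_poly \<omega> \<rho> c d \<alpha> (Suc (Suc n)) =
     smult (\<rho> (Suc n)) [:- c n, 1:] * L_poly \<omega> \<rho> c d \<alpha> (Suc n)
     - smult (d (Suc n)) [:\<omega>\<^sup>2, 0, 1:] * L_poly \<omega> \<rho> c d \<alpha> n"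
proof (rule poly_eq_poly_eq_iff[THEN iffD1], rule ext)
  fix t
  have shift: "\<alpha> (Suc (Suc n)) = \<rho> (Suc n) * (c n + \<alpha> (Suc n) / \<rho> n) - \<rho> (Suc n) * c (Suc n)"
    using \<alpha>_shift[of n] by simp
  show "poly (L_poly \<omega> \<rho> c d \<alpha> (Suc (Suc n))) t =
     poly (smult (\<rho> (Suc n)) [:- c n, 1:] * L_poly \<omega> \<rho> c d \<alpha> (Suc n)
     - smult (d (Suc n)) [:\<omega>\<^sup>2, 0, 1:] * L_poly \<omega> \<rho> c d \<alpha> n) t"
  proof (cases n)
    case 0
    show ?thesis
      unfolding L_poly_def shift using \<rho>_nz[of 0] by (simp add: 0 field_simps power2_eq_square)
  next
    case (Suc k)
    define p q r where "p = poly (P_poly \<omega> \<rho> c d (Suc n)) t" and "q = poly (P_poly \<omega> \<rho> c d n) t"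
      and "r = (t\<^sup>2 + \<omega>\<^sup>2) * poly (P_poly \<omega> \<rho> c d k) t"
    have p: "p = \<rho> n * (t - c n) * q - d n * r"
      unfolding p_def q_def r_def Suc by (simp add: power2_eq_square algebra_simps)
    have "d (Suc n) * \<alpha> n * \<rho> n = d n * \<alpha> (Suc n) * \<rho> (Suc n)"
      using d_\<alpha>_rec[of "Suc n"] by simp
    then have \<alpha>d: "d (Suc n) * \<alpha> n = d n * \<alpha> (Suc n) * \<rho> (Suc n) / \<rho> n"
      using \<rho>_nz[of n] by (simp add: field_simps)
    have L2: "poly (L_poly \<omega> \<rho> c d \<alpha> (Suc (Suc n))) t =
        \<rho> (Suc n) * (t - c (Suc n)) * p - d (Suc n) * (t\<^sup>2 + \<omega>\<^sup>2) * q - \<alpha> (Suc (Suc n)) * p"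
      by (simp add: L_poly_def p_def q_def power2_eq_square algebra_simps)
    have L1: "poly (L_poly \<omega> \<rho> c d \<alpha> (Suc n)) t = p - \<alpha> (Suc n) * q"
      by (simp add: L_poly_def p_def q_def)
    have L0: "(t\<^sup>2 + \<omega>\<^sup>2) * poly (L_poly \<omega> \<rho> c d \<alpha> n) t = (t\<^sup>2 + \<omega>\<^sup>2) * q - \<alpha> n * r"
      by (simp add: L_poly_def q_def r_def Suc algebra_simps)
    have "poly (smult (\<rho> (Suc n)) [:- c n, 1:] * L_poly \<omega> \<rho> c d \<alpha> (Suc n)
        - smult (d (Suc n)) [:\<omega>\<^sup>2, 0, 1:] * L_poly \<omega> \<rho> c d \<alpha> n) t
      = \<rho> (Suc n) * (t - c n) * (p - \<alpha> (Suc n) * q)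
        - d (Suc n) * ((t\<^sup>2 + \<omega>\<^sup>2) * poly (L_poly \<omega> \<rho> c d \<alpha> n) t)"
      by (simp add: L1 power2_eq_square algebra_simps)
    also have "\<dots> = \<rho> (Suc n) * (t - c n) * (p - \<alpha> (Suc n) * q)
        - d (Suc n) * (t\<^sup>2 + \<omega>\<^sup>2) * q + (d (Suc n) * \<alpha> n) * r"
      unfolding L0 by (simp add: algebra_simps)
    also have "\<dots> = poly (L_poly \<omega> \<rho> c d \<alpha> (Suc (Suc n))) t"
      unfolding L2 shift \<alpha>d p using \<rho>_nz[of n] by (simp add: field_simps)
    finally show ?thesis ..
  qed
qed

lemma Lc_rec:
  fixes z :: complex
  shows "Lc (Suc (Suc n)) z =
     \<rho> (Suc n) * (z - \<gamma> (Suc n)) * Lc (Suc n) z - d (Suc n) * (z\<^sup>2 + of_real (\<omega>\<^sup>2)) * Lc n z"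
  unfolding L_poly_rec map_poly_of_real_diff map_poly_of_real_mult poly_diff poly_mult
  by (simp add: map_poly_of_real_smult map_poly_pCons \<gamma>_def power2_eq_square algebra_simps)

text \<open>
  The common shape of the two families of rational functions: \<open>\<tau> = \<i>\<omega>\<close> gives \<open>u\<^sup>R\<close> and
  \<open>\<tau> = -\<i>\<omega>\<close> gives \<open>u\<^sup>L\<close>.
\<close>

definition uF :: "complex \<Rightarrow> nat \<Rightarrow> complex \<Rightarrow> complex" where
  "uF \<tau> k z = (-1) ^ k * Lc k z / ((z - \<tau>) ^ k * of_real (\<Prod>j=1..k. sqrt (d j)))"

abbreviation UR :: "nat \<Rightarrow> complex \<Rightarrow> complex" where "UR \<equiv> uR \<omega> \<rho> c d \<alpha>"
abbreviation UL :: "nat \<Rightarrow> complex \<Rightarrow> complex" where "UL \<equiv> uL \<omega> \<rho> c d \<alpha>"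

lemma UR_eq_uF: "UR k = uF (\<i> * of_real \<omega>) k"
  by (auto simp: uR_def uF_def)

lemma UL_eq_uF: "UL k = uF (- \<i> * of_real \<omega>) k"
  by (auto simp: uL_def uF_def)

lemma uF_0: "uF \<tau> 0 z = 1"
  by (simp add: uF_def Lc_0)

lemma uF_1:
  fixes z \<tau> :: complex
  assumes "z \<noteq> \<tau>"
  shows "(z - \<tau>) * sqrt (d 1) * uF \<tau> 1 z = - (\<rho> 0 * (z - \<gamma> 0) * uF \<tau> 0 z)"
  using assms d_pos[of 1] by (simp add: uF_def Lc_0 Lc_1)

lemma uF_rec:
  fixes z \<tau> :: complex
  assumes "\<tau>\<^sup>2 = - of_real (\<omega>\<^sup>2)" "z \<noteq> \<tau>"
  shows "(z - \<tau>) * sqrt (d (Suc (Suc k))) * uF \<tau> (Suc (Suc k)) z =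
    - (\<rho> (Suc k) * (z - \<gamma> (Suc k)) * uF \<tau> (Suc k) z) - (z + \<tau>) * sqrt (d (Suc k)) * uF \<tau> k z"
proof -
  define s1 s2 :: complex where "s1 = of_real (sqrt (d (Suc k)))"
    and "s2 = of_real (sqrt (d (Suc (Suc k))))"
  define D :: complex where "D = of_real (\<Prod>j=1..k. sqrt (d j))"
  define A where "A = (z - \<tau>) ^ k"
  have D: "D \<noteq> 0" and s: "s1 \<noteq> 0" "s2 \<noteq> 0" and A: "A \<noteq> 0" and z: "z - \<tau> \<noteq> 0"
    using d_nz assms(2) by (auto simp: D_def s1_def s2_def A_def)
  have "d (Suc k) = sqrt (d (Suc k)) * sqrt (d (Suc k))" using d_pos[of "Suc k"] by simp
  then have d1: "of_real (d (Suc k)) = s1 * s1" unfolding s1_def of_real_mult[symmetric] by simp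
  have sq: "z\<^sup>2 + of_real (\<omega>\<^sup>2) = (z - \<tau>) * (z + \<tau>)"
    using assms(1) by (simp add: power2_eq_square algebra_simps)
  have u0: "uF \<tau> k z = (-1) ^ k * Lc k z / (A * D)"
    by (simp add: uF_def A_def D_def)
  have u1: "uF \<tau> (Suc k) z = - ((-1) ^ k * Lc (Suc k) z) / ((z - \<tau>) * A * (D * s1))"
    by (simp add: uF_def A_def D_def s1_def)
  have u2: "uF \<tau> (Suc (Suc k)) z =
      (-1) ^ k * Lc (Suc (Suc k)) z / ((z - \<tau>) * (z - \<tau>) * A * (D * s1 * s2))"
    by (simp add: uF_def A_def D_def s1_def s2_def)
  show ?thesis
    unfolding u0 u1 u2 Lc_rec d1 sq s1_def[symmetric] s2_def[symmetric]
    using D s A z by (simp add: divide_simps) (simp add: algebra_simps)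
qed

section \<open>The Christoffel--Darboux identity and the zeros\<close>

text \<open>Real coefficients make the two families conjugate to each other.\<close>

lemma cnj_UR: "cnj (UR k z) = UL k (cnj z)"
proof -
  have "cnj (Lc k z) = Lc k (cnj z)"
    by (rule poly_cnj_real) (simp add: coeff_map_poly)
  then show ?thesis by (simp add: uR_def uL_def)
qed

lemma christoffel_darboux:
  assumes "x \<noteq> \<i> * of_real \<omega>" "y \<noteq> - \<i> * of_real \<omega>"
  shows "(x - y) * tridiag_form \<rho> d (Suc N) (\<lambda>i. UL i y) (\<lambda>i. UR i x) =
    - of_real (sqrt (d (Suc N))) *
      ((x - \<i> * of_real \<omega>) * UL N y * UR (Suc N) x - (y + \<i> * of_real \<omega>) * UL (Suc N) y * UR N x)"
proof (induction N)
  case 0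
  define \<tau> where "\<tau> = \<i> * complex_of_real \<omega>"
  define s where "s = complex_of_real (sqrt (d (Suc 0)))"
  have R: "(x - \<tau>) * s * UR (Suc 0) x = - (\<rho> 0 * (x - \<gamma> 0) * UR 0 x)"
    using uF_1[OF assms(1)] by (simp add: UR_eq_uF \<tau>_def s_def)
  have L: "(y + \<tau>) * s * UL (Suc 0) y = - (\<rho> 0 * (y - \<gamma> 0) * UL 0 y)"
    using uF_1[OF assms(2)] by (simp add: UL_eq_uF \<tau>_def s_def)
  have "- s * ((x - \<tau>) * UL 0 y * UR (Suc 0) x - (y + \<tau>) * UL (Suc 0) y * UR 0 x) =
    - (UL 0 y * ((x - \<tau>) * s * UR (Suc 0) x)) + UR 0 x * ((y + \<tau>) * s * UL (Suc 0) y)"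
    by (simp add: algebra_simps)
  also have "\<dots> = (x - y) * tridiag_form \<rho> d (Suc 0) (\<lambda>i. UL i y) (\<lambda>i. UR i x)"
    unfolding R L tridiag_form_1 by (simp add: algebra_simps)
  finally show ?case by (simp add: \<tau>_def s_def)
next
  case (Suc N)
  define \<tau> where "\<tau> = \<i> * complex_of_real \<omega>"
  define s t where "s = complex_of_real (sqrt (d (Suc N)))"
    and "t = complex_of_real (sqrt (d (Suc (Suc N))))"
  have \<tau>2: "(\<i> * complex_of_real \<omega>)\<^sup>2 = - of_real (\<omega>\<^sup>2)" "(- \<i> * complex_of_real \<omega>)\<^sup>2 = - of_real (\<omega>\<^sup>2)"
    by (simp_all add: power_mult_distrib)
  have R: "(x - \<tau>) * t * UR (Suc (Suc N)) x =
      - (\<rho> (Suc N) * (x - \<gamma> (Suc N)) * UR (Suc N) x) - (x + \<tau>) * s * UR N x"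
    using uF_rec[OF \<tau>2(1) assms(1), of N] by (simp add: UR_eq_uF \<tau>_def s_def t_def)
  have L: "(y + \<tau>) * t * UL (Suc (Suc N)) y =
      - (\<rho> (Suc N) * (y - \<gamma> (Suc N)) * UL (Suc N) y) - (y - \<tau>) * s * UL N y"
    using uF_rec[OF \<tau>2(2) assms(2), of N] by (simp add: UL_eq_uF \<tau>_def s_def t_def)
  have IH: "(x - y) * tridiag_form \<rho> d (Suc N) (\<lambda>i. UL i y) (\<lambda>i. UR i x) =
      - s * ((x - \<tau>) * UL N y * UR (Suc N) x - (y + \<tau>) * UL (Suc N) y * UR N x)"
    using Suc by (simp add: s_def \<tau>_def)
  have "- t * ((x - \<tau>) * UL (Suc N) y * UR (Suc (Suc N)) x
        - (y + \<tau>) * UL (Suc (Suc N)) y * UR (Suc N) x) =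
      - (UL (Suc N) y * ((x - \<tau>) * t * UR (Suc (Suc N)) x))
        + UR (Suc N) x * ((y + \<tau>) * t * UL (Suc (Suc N)) y)"
    by (simp add: algebra_simps)
  also have "\<dots> = (x - y) * tridiag_form \<rho> d (Suc N) (\<lambda>i. UL i y) (\<lambda>i. UR i x)
      + (x - y) * (of_real (\<rho> (Suc N)) * UL (Suc N) y * UR (Suc N) x
        + s * (UL N y * UR (Suc N) x + UL (Suc N) y * UR N x))"
    unfolding R L IH by (simp add: algebra_simps)
  also have "\<dots> = (x - y) * tridiag_form \<rho> d (Suc (Suc N)) (\<lambda>i. UL i y) (\<lambda>i. UR i x)"
    unfolding tridiag_form_Suc_Suc s_def by (simp add: algebra_simps)
  finally show ?case by (simp add: t_def \<tau>_def)
qed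

text \<open>At \<open>\<plusminus>\<i>\<omega>\<close> the second term of the recurrence vanishes, and the linear factors have real zeros.\<close>

lemma Lc_nz_at_pole:
  assumes "\<tau>\<^sup>2 = - of_real (\<omega>\<^sup>2)"
  shows "Lc k \<tau> \<noteq> 0"
proof -
  have lin: "\<tau> - of_real r \<noteq> 0" for r
  proof
    assume "\<tau> - of_real r = 0"
    then have "\<tau> = of_real r" by simp
    with assms have "complex_of_real (r\<^sup>2) = of_real (- (\<omega>\<^sup>2))" by simp
    then have "r\<^sup>2 = - (\<omega>\<^sup>2)" by (rule of_real_eq_iff[THEN iffD1])
    moreover have "\<omega>\<^sup>2 > 0" using \<omega>_nz by simp
    ultimately show False using zero_le_power2[of r] by linarith
  qed
  have "Lc (Suc k) \<tau> \<noteq> 0" for k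
    by (induction k) (use lin \<rho>_nz assms in \<open>auto simp: Lc_1 Lc_rec\<close>)
  then show ?thesis by (cases k) (auto simp: Lc_0)
qed

lemma Lc_zero_imp:
  assumes "Lc n z = 0"
  shows "z \<noteq> \<i> * of_real \<omega>" "z \<noteq> - \<i> * of_real \<omega>" "UR n z = 0" "UL n z = 0"
  using Lc_nz_at_pole[of z n] assms by (auto simp: uR_def uL_def power_mult_distrib)

lemma UR_differentiable:
  assumes "z \<noteq> \<i> * of_real \<omega>"
  shows "UR k field_differentiable at z"
proof -
  have pd: "Lc k field_differentiable at z"
    unfolding field_differentiable_def using poly_DERIV by blast
  have "(\<Prod>j=1..k. sqrt (d j)) \<noteq> 0" using d_nz by auto
  then show ?thesis
    unfolding uR_def[abs_def] using assms
    by (intro derivative_intros pd) auto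
qed

lemma deriv_UR_at_double_zero:
  assumes "Lc n z = 0" "poly (pderiv (L_cpoly \<omega> \<rho> c d \<alpha> n)) z = 0"
  shows "deriv (UR n) z = 0"
proof -
  define h where "h w = (-1) ^ n * ((w - \<i> * of_real \<omega>) ^ n * of_real (\<Prod>j=1..n. sqrt (d j)))"
    for w :: complex
  have z: "z \<noteq> \<i> * of_real \<omega>" using Lc_zero_imp(1)[OF assms(1)] .
  have hz: "h z \<noteq> 0" using z d_nz by (simp add: h_def)
  have "h field_differentiable at z"
    unfolding h_def by (intro derivative_intros)
  then obtain h' where h': "(h has_field_derivative h') (at z)"
    unfolding field_differentiable_def by blast
  have "((\<lambda>w. Lc n w / h w) has_field_derivative 0) (at z)"
    using DERIV_divide[OF poly_DERIV h' hz, of "L_cpoly \<omega> \<rho> c d \<alpha> n"] assms by simp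
  moreover have "UR n = (\<lambda>w. Lc n w / h w)"
  proof
    fix w
    have "(-1) ^ n * a = a / (-1) ^ n" for a :: complex
      by (cases "even n") auto
    then show "UR n w = Lc n w / h w"
      by (simp add: uR_def h_def)
  qed
  ultimately show ?thesis by (simp add: DERIV_imp_deriv)
qed

text \<open>The confluent case of the Christoffel--Darboux identity, by differentiation in \<open>x\<close> at \<open>x = z\<close>.\<close>

lemma tridiag_form_at_zero:
  assumes "Lc (Suc N) z = 0"
  shows "tridiag_form \<rho> d (Suc N) (\<lambda>i. UL i z) (\<lambda>i. UR i z) =
    weight_recip \<omega> \<rho> c d \<alpha> (Suc N) z z"
proof -
  define \<tau> where "\<tau> = \<i> * complex_of_real \<omega>"
  define F where "F x = tridiag_form \<rho> d (Suc N) (\<lambda>i. UL i z) (\<lambda>i. UR i x)" for x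
  define G where "G x = - of_real (sqrt (d (Suc N))) * UL N z * ((x - \<tau>) * UR (Suc N) x)" for x
  note z = Lc_zero_imp[OF assms]
  have z\<tau>: "z \<noteq> \<tau>" using z(1) by (simp add: \<tau>_def)
  have "F field_differentiable at z"
    unfolding F_def tridiag_form_def using z(1)
    by (intro derivative_intros UR_differentiable)
  then obtain F' where "(F has_field_derivative F') (at z)"
    unfolding field_differentiable_def by blast
  then have dF: "((\<lambda>x. (x - z) * F x) has_field_derivative F z) (at z)"
    by (auto intro!: derivative_eq_intros)
  have "(UR (Suc N) has_field_derivative deriv (UR (Suc N)) z) (at z)"
    using UR_differentiable[OF z(1)] by (simp add: field_differentiable_derivI)
  then have dG: "(G has_field_derivative weight_recip \<omega> \<rho> c d \<alpha> (Suc N) z z) (at z)"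
    unfolding G_def using z(3)
    by (auto intro!: derivative_eq_intros simp: weight_recip_def \<tau>_def)
  have eq: "(x - z) * F x = G x" if "x \<in> - {\<tau>}" for x
  proof -
    have "x \<noteq> \<i> * of_real \<omega>" using that by (simp add: \<tau>_def)
    from christoffel_darboux[OF this z(2), of N] z(4) show ?thesis
      by (simp add: F_def G_def \<tau>_def)
  qed
  have "((\<lambda>x. (x - z) * F x) has_field_derivative weight_recip \<omega> \<rho> c d \<alpha> (Suc N) z z) (at z)"
    by (rule has_field_derivative_transform_within_open[OF dG, of "- {\<tau>}"]) (use z\<tau> eq in auto)
  from DERIV_unique[OF dF this] show ?thesis by (simp add: F_def)
qed

end

section \<open>Biorthogonality\<close>

theorem theorem3p4:
  fixes \<omega> m0 :: real and \<rho> c d \<alpha> :: "nat \<Rightarrow> real" and n :: nat and x :: "nat \<Rightarrow> complex"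
  assumes "\<omega> \<noteq> 0"
    and "\<And>k. \<rho> k \<ge> 1"
    and "positive_chain_sequence d"
    and "\<And>k. \<alpha> k \<noteq> 0"
    and "\<And>k. k \<ge> 1 \<Longrightarrow>
           \<alpha> k = \<rho> (k - 1) * (1 - c (k - 1)) - \<omega>\<^sup>2 * inverse (\<alpha> (k - 1)) * d (k - 1)"
    and "\<And>k. k \<ge> 1 \<Longrightarrow> d k * \<alpha> (k - 1) * \<rho> (k - 1) = d (k - 1) * \<alpha> k * \<rho> k"
    and "n \<ge> 1"
    and "m0 > 0"
    and "\<And>i. i + 1 < n \<Longrightarrow> (UL_m \<rho> d m0 i)\<^sup>2 < \<rho> i"
    and "UL_l \<rho> d m0 n = 0"
    and zeros: "image_mset x (mset_set {1..n}) = proots (L_cpoly \<omega> \<rho> c d \<alpha> n)"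
  shows "\<forall>j\<in>{1..n}. \<forall>k\<in>{1..n}.
      weight_recip \<omega> \<rho> c d \<alpha> n (x j) (x k) \<noteq> 0 \<and>
      (\<Sum>i<n. Y_fun \<rho> d m0 (uL \<omega> \<rho> c d \<alpha>) i (x j) * Y_fun \<rho> d m0 (uR \<omega> \<rho> c d \<alpha>) i (x k)
         * inverse (weight_recip \<omega> \<rho> c d \<alpha> n (x j) (x k))) = (if j = k then 1 else 0) \<and>
      (\<Sum>i<n. Z_fun \<rho> d n (uL \<omega> \<rho> c d \<alpha>) i (x j) * Z_fun \<rho> d n (uR \<omega> \<rho> c d \<alpha>) i (x k)
         * inverse (weight_recip \<omega> \<rho> c d \<alpha> n (x j) (x k))) = (if j = k then 1 else 0)"
proof -
  interpret kernel_recurrence \<omega> \<rho> c d \<alpha>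
  proof
    \<comment> \<open>Both factors of \<open>d k\<close> are positive, since all chain parameters are less than 1.\<close>
    show "d k > 0" if "k \<ge> 1" for k
    proof -
      obtain \<xi> where \<xi>0: "\<xi> 0 < 1"
        and \<xi>: "\<And>n. n \<ge> 1 \<Longrightarrow> 0 < \<xi> n \<and> \<xi> n < 1 \<and> d n = (1 - \<xi> (n - 1)) * \<xi> n"
        using assms(3) unfolding positive_chain_sequence_def by blast
      have "\<xi> (k - 1) < 1" using \<xi>0 \<xi>[of "k - 1"] by (cases "k - 1") auto
      then show ?thesis using \<xi>[OF that] by simp
    qed
  qed (use assms in auto)
  obtain N where n: "n = Suc N" using assms(7) by (cases n) auto
  let ?p = "L_cpoly \<omega> \<rho> c d \<alpha> n"
  let ?W = "weight_recip \<omega> \<rho> c d \<alpha> n"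
  define S where "S y x = tridiag_form \<rho> d n (\<lambda>i. UL i y) (\<lambda>i. UR i x)" for y x
  have Y: "(\<Sum>i<n. Y_fun \<rho> d m0 UL i y * Y_fun \<rho> d m0 UR i x) = S y x" for y x
    unfolding S_def using sum_Y_eq_tridiag_form assms(7,9,10) by blast
  have Z: "(\<Sum>i<n. Z_fun \<rho> d n UL i y * Z_fun \<rho> d n UR i x) = S y x" for y x
    unfolding S_def
    by (rule sum_Z_eq_tridiag_form[where \<rho> = \<rho>, OF assms(7) LDU_e_pos[OF assms(2,3)] d_pos])
  have S0: "(x - y) * S y x = 0" if "Lc n x = 0" "Lc n y = 0" for x y
    using christoffel_darboux[of x y N] Lc_zero_imp[OF that(1)] Lc_zero_imp[OF that(2)]
    by (simp add: S_def n)
  \<comment> \<open>For conjugate arguments the sum of the \<open>Y\<close>-products is a sum of squared moduli, and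
      its term of index 0 is \<open>m0\<^sup>2\<close>.\<close>
  have cnj_Y: "cnj (Y_fun \<rho> d m0 UR i z) = Y_fun \<rho> d m0 UL i (cnj z)" for i z
    by (cases i) (simp_all add: cnj_UR)
  have S_pos: "S (cnj z) z \<noteq> 0" for z
  proof -
    have "S (cnj z) z = of_real (\<Sum>i<n. (cmod (Y_fun \<rho> d m0 UR i z))\<^sup>2)"
      unfolding Y[symmetric] cnj_Y[symmetric] of_real_sum
      by (intro sum.cong refl) (simp only: complex_norm_square mult.commute)
    moreover have "Y_fun \<rho> d m0 UR 0 z = of_real m0"
      by (simp add: UR_eq_uF uF_0)
    then have "(\<Sum>i<n. (cmod (Y_fun \<rho> d m0 UR i z))\<^sup>2) > 0"
      using assms(8) n by (intro sum_pos2[of _ 0]) auto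
    ultimately show ?thesis by (simp del: of_real_sum of_real_power)
  qed
  have W_nz: "?W z z \<noteq> 0" and S_W: "S z z = ?W z z" if "Lc n z = 0" for z
  proof -
    have "Lc n (cnj z) = cnj (Lc n z)"
      by (rule poly_cnj_real[symmetric]) (simp add: coeff_map_poly)
    with that have "Lc n (cnj z) = 0" by simp
    \<comment> \<open>Hence the zero is real.\<close>
    from S0[OF that this] S_pos[of z] have "cnj z = z" by simp
    with S_pos[of z] have "S z z \<noteq> 0" by simp
    moreover show "S z z = ?W z z"
      using tridiag_form_at_zero[of N z] that by (simp add: S_def n)
    ultimately show "?W z z \<noteq> 0" by simp
  qed
  have p_nz: "?p \<noteq> 0"
    using Lc_nz_at_pole[of "\<i> * of_real \<omega>" n] by (auto simp: power_mult_distrib)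
  have zero: "Lc n (x j) = 0" if "j \<in> {1..n}" for j
  proof -
    have "x j \<in># proots ?p" unfolding zeros[symmetric] using that by simp
    then show ?thesis using p_nz by simp
  qed
  \<comment> \<open>A repetition among the \<open>x j\<close> would be a multiple root, at which the derivative in the weight
      vanishes.\<close>
  have inj: "x j \<noteq> x k" if "j \<in> {1..n}" "k \<in> {1..n}" "j \<noteq> k" for j k
  proof
    assume eq: "x j = x k"
    have "poly (pderiv ?p) (x j) \<noteq> 0"
      using deriv_UR_at_double_zero[OF zero[OF that(1)]] W_nz[OF zero[OF that(1)]]
      by (auto simp: weight_recip_def)
    then have "order (x j) ?p \<le> 1"
      using order_pderiv[of ?p "x j"] order_root[of "pderiv ?p" "x j"] p_nz zero[OF that(1)]
      by (simp add: order_root)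
    then have "count (image_mset x (mset_set {1..n})) (x j) \<le> 1"
      unfolding zeros using p_nz by simp
    moreover have "image_mset x (mset_set {j, k}) \<subseteq># image_mset x (mset_set {1..n})"
      using that by (intro image_mset_subseteq_mono subset_imp_msubset_mset_set) auto
    then have "count (image_mset x (mset_set {j, k})) (x j)
        \<le> count (image_mset x (mset_set {1..n})) (x j)"
      by (rule mset_subset_eq_count)
    moreover have "count (image_mset x (mset_set {j, k})) (x j) = 2"
      using that(3) eq by simp
    ultimately show False by linarith
  qed
  \<comment> \<open>Each factor of the mixed weight depends on one zero only and is a factor of the weight at
      that zero.\<close>
  have W_nz2: "?W (x j) (x k) \<noteq> 0" if "j \<in> {1..n}" "k \<in> {1..n}" for j k
    using W_nz[OF zero[OF that(1)]] W_nz[OF zero[OF that(2)]] by (simp add: weight_recip_def)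
  have S_delta: "S (x j) (x k) * inverse (?W (x j) (x k)) = (if j = k then 1 else 0)"
    if "j \<in> {1..n}" "k \<in> {1..n}" for j k
    using S0[OF zero[OF that(2)] zero[OF that(1)]] inj[OF that] S_W[OF zero[OF that(1)]]
      W_nz[OF zero[OF that(1)]] by auto
  show ?thesis
    unfolding sum_distrib_right[symmetric] Y Z using W_nz2 S_delta by blast
qed

end
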